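(* Let $r,x$ be complex numbers. Then, as formal power series in $t$, $$\sum_{n=0}^{\infty}D_n^{(r)}(x)\frac{t^n}{n!}=(1+t^2)^{-r-\frac12}\, e^{x\arctan t},$$ where $\arctan t=\sum_{k\ge0}(-1)^k t^{2k+1}/(2k+1)$ and $(1+t^2)^{-r-\frac12}=\sum_{k\ge0}\binom{-r-\frac12}{k}t^{2k}$.
   Context: For a complex number $a$ and integer $k\ge0$, $\binom{a}{k}=a(a-1)\cdots(a-k+1)/k!$. The polynomials $D_n^{(r)}(x)$ are defined by $D_{-1}^{(r)}(x)=0$, $D_0^{(r)}(x)=1$ and $D_{n+1}^{(r)}(x)=xD_n^{(r)}(x)-n(n+2r)D_{n-1}^{(r)}(x)$ for $n\ge0$. *)

theory Defs
  imports
    "HOL-Computational_Algebra.Polynomial"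
    "HOL-Computational_Algebra.Formal_Power_Series"
begin

(* The index starts at 0; the convention D_{-1} = 0 is the conditional, which yields D_1 = x. *)
fun D_poly :: "complex \<Rightarrow> nat \<Rightarrow> complex poly" where
  "D_poly r 0 = 1"
| "D_poly r (Suc n) =
     [:0, 1:] * D_poly r n
     - smult (of_nat n * (of_nat n + 2 * r)) (if n = 0 then 0 else D_poly r (n - 1))"

(* For odd n = 2 * k + 1 we have n div 2 = k. *)
definition fps_arctan :: "complex fps" where
  "fps_arctan = Abs_fps (\<lambda>n. if odd n then (-1) ^ (n div 2) / of_nat n else 0)"

(* The binomial series in t^2: \<Sum>k. (a gchoose k) * t^(2*k). *)
definition fps_one_plus_X2_powr :: "complex \<Rightarrow> complex fps" where
  "fps_one_plus_X2_powr a = fps_binomial a oo fps_X ^ 2"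

end

theory Submission
  imports Defs
begin

text \<open>
  Both sides solve \<open>(1 + t\<^sup>2) G' = (x - (1 + 2 r) t) G\<close> with \<open>G(0) = 1\<close>: comparing
  coefficients turns this equation into the recurrence of \<open>D_poly\<close>, and the product on
  the right satisfies it because \<open>(1 + t\<^sup>2) arctan' = 1\<close>.
\<close>

text \<open>Termwise differentiation gives the alternating geometric series in \<open>t^2\<close>;
  under the factor \<open>1 + t^2\<close> neighbouring even coefficients cancel and only the
  constant term survives.\<close>

lemma fps_arctan_deriv:
  includes fps_syntax
  shows "(1 + fps_X ^ 2) * fps_deriv fps_arctan = 1"
proof (rule fps_ext)
  have deriv: "fps_deriv fps_arctan = Abs_fps (\<lambda>k. if even k then (-1) ^ (k div 2) else 0)"
  proof (rule fps_ext)
    show "fps_deriv fps_arctan $ k = Abs_fps (\<lambda>k. if even k then (-1) ^ (k div 2) else 0) $ k" for k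
      using of_nat_neq_0[of k, where ?'a = complex] by (simp add: fps_arctan_def)
  qed
  show "((1 + fps_X ^ 2) * fps_deriv fps_arctan) $ n = 1 $ n" for n
  proof (cases "n < 2")
    case True
    then consider "n = 0" | "n = 1" by linarith
    then show ?thesis
      by cases (simp_all add: deriv distrib_right fps_X_power_mult_nth)
  next
    case False
    then obtain m where n: "n = Suc (Suc m)"
      by (metis add_2_eq_Suc le_Suc_ex not_less)
    show ?thesis
      by (simp add: deriv n distrib_right fps_X_power_mult_nth del: fps_deriv_nth)
  qed
qed

text \<open>The equation \<open>(1 + t) B' = a B\<close> of the binomial series is composed with
  \<open>t^2\<close>; the chain rule supplies the factor \<open>2 t\<close>.\<close>

lemma fps_one_plus_X2_powr_deriv:
  "(1 + fps_X ^ 2) * fps_deriv (fps_one_plus_X2_powr a)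
     = fps_const (2 * a) * fps_X * fps_one_plus_X2_powr a"
proof -
  let ?B = "fps_binomial a"
  have "(1 + fps_X) * fps_deriv ?B = fps_const a * ?B"
    unfolding fps_binomial_deriv
    \<comment> \<open>The library gives the derivative as a quotient by \<open>1 + t\<close>, a unit
      since its constant term is 1.\<close>
    by (rule dvd_mult_div_cancel, rule unit_imp_dvd) simp
  then have "((1 + fps_X) * fps_deriv ?B) oo fps_X ^ 2 = (fps_const a * ?B) oo fps_X ^ 2"
    by (rule arg_cong)
  then have ode: "(1 + fps_X ^ 2) * (fps_deriv ?B oo fps_X ^ 2) = fps_const a * (?B oo fps_X ^ 2)"
    by (simp add: fps_compose_mult_distrib fps_compose_add_distrib)
  have "fps_deriv (fps_one_plus_X2_powr a)
      = (fps_deriv ?B oo fps_X ^ 2) * (2 * fps_X)"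
    unfolding fps_one_plus_X2_powr_def
    by (subst fps_compose_deriv) (simp_all add: fps_deriv_power flip: numeral_fps_const)
  then have "(1 + fps_X ^ 2) * fps_deriv (fps_one_plus_X2_powr a)
      = (1 + fps_X ^ 2) * (fps_deriv ?B oo fps_X ^ 2) * (2 * fps_X)"
    by (simp only: mult.assoc)
  also have "\<dots> = fps_const a * 2 * fps_X * fps_one_plus_X2_powr a"
    unfolding ode fps_one_plus_X2_powr_def by (simp only: mult_ac)
  also have "fps_const a * 2 = fps_const (2 * a)"
    by (simp add: numeral_fps_const mult.commute)
  finally show ?thesis .
qed

text \<open>The equation determines each coefficient from the two before it; scaling by factorials
  turns this into the recurrence of \<open>D_poly\<close>.\<close>

lemma fps_nth_ODE_eq_D_poly:
  includes fps_syntax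
  assumes ode: "(1 + fps_X ^ 2) * fps_deriv G = (fps_const x - fps_const (1 + 2 * r) * fps_X) * G"
    and init: "G $ 0 = 1"
  shows "G $ n = poly (D_poly r n) x / fact n"
proof (induction n rule: less_induct)
  case (less n)
  consider "n = 0" | "n = 1" | m where "n = Suc (Suc m)"
    by (metis One_nat_def not0_implies_Suc)
  then show ?case
  proof cases
    case 1
    then show ?thesis by (simp add: init)
  next
    case 2
    then show ?thesis
      using arg_cong[OF ode, of "\<lambda>F. F $ 0"] by (simp add: init)
  next
    case 3
    \<comment> \<open>Coefficient of \<open>t^(m+1)\<close>. For \<open>m = 0\<close> the shifted
      series \<open>t^2 G'\<close> contributes nothing, in agreement with
      \<open>of_nat m = 0\<close>.\<close>
    have "of_nat n * G $ n + of_nat m * G $ m = x * G $ Suc m - (1 + 2 * r) * G $ m"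
      using arg_cong[OF ode, of "\<lambda>F. F $ Suc m"] unfolding 3
      by (cases m) (simp_all add: distrib_right left_diff_distrib mult.assoc fps_X_power_mult_nth)
    then have "of_nat n * G $ n = x * G $ Suc m - (of_nat (Suc m) + 2 * r) * G $ m"
      by (simp add: algebra_simps)
    also have "\<dots> = x * (poly (D_poly r (Suc m)) x / fact (Suc m))
        - (of_nat (Suc m) + 2 * r) * (poly (D_poly r m) x / fact m)"
      using less 3 by simp
    \<comment> \<open>Writing \<open>1 / fact m\<close> as \<open>(m + 1) / fact (m + 1)\<close>
      produces the factor \<open>m + 1\<close> of the recurrence.\<close>
    also have "\<dots> = poly (D_poly r n) x / fact (Suc m)"
      unfolding 3 by (simp del: of_nat_Suc add: field_simps)
    finally show ?thesis
      unfolding 3 by (simp add: field_simps del: of_nat_Suc D_poly.simps)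
  qed
qed

theorem theorem3p4:
  fixes r x :: complex
  shows "Abs_fps (\<lambda>n. poly (D_poly r n) x / fact n)
           = fps_one_plus_X2_powr (- r - 1 / 2) * (fps_exp 1 oo (fps_const x * fps_arctan))"
proof -
  include fps_syntax
  define P where "P = fps_one_plus_X2_powr (- r - 1 / 2)"
  define E where "E = fps_exp 1 oo (fps_const x * fps_arctan)"
  \<comment> \<open>The exponent enters doubled: \<open>2 (-r - 1/2) = -(1 + 2 r)\<close>.\<close>
  have P: "(1 + fps_X ^ 2) * fps_deriv P = - (fps_const (1 + 2 * r) * fps_X * P)"
    unfolding P_def fps_one_plus_X2_powr_deriv by (simp add: fps_eq_iff algebra_simps)
  have "fps_deriv E = fps_const x * E * fps_deriv fps_arctan"
    \<comment> \<open>The chain rule applies because \<open>fps_arctan\<close> has zero constant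
      term.\<close>
    unfolding E_def by (subst fps_compose_deriv) (simp_all add: fps_arctan_def algebra_simps)
  then have "(1 + fps_X ^ 2) * fps_deriv E = fps_const x * E * ((1 + fps_X ^ 2) * fps_deriv fps_arctan)"
    by (simp only: mult_ac)
  then have E: "(1 + fps_X ^ 2) * fps_deriv E = fps_const x * E"
    by (simp add: fps_arctan_deriv)
  have "(1 + fps_X ^ 2) * fps_deriv (P * E)
      = ((1 + fps_X ^ 2) * fps_deriv P) * E + P * ((1 + fps_X ^ 2) * fps_deriv E)"
    by (simp add: algebra_simps)
  also have "\<dots> = (fps_const x - fps_const (1 + 2 * r) * fps_X) * (P * E)"
    unfolding P E by (simp add: algebra_simps)
  finally have "(P * E) $ n = poly (D_poly r n) x / fact n" for n
    by (rule fps_nth_ODE_eq_D_poly) (simp add: P_def E_def fps_one_plus_X2_powr_def)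
  then show ?thesis
    by (simp add: fps_eq_iff P_def E_def)
qed

end
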